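(* Let $S(z,\mathbf t)$ be a solution of the dispersionless BKP hierarchy with $\tau$-function $F(\mathbf t)$, $\mathbf t=(t_1,t_3,t_5,\dots)$, and put $x=t_1$, $y=t_3$, $p(z)=\partial_xS(z)$, $u=-\partial_x\widetilde S_1$. Let $z_1,\dots,z_N\in\mathbb C$ be points, $c_1,\dots,c_N$ constants, $S_i=S(z_i,\mathbf t)$, $p_i=p(z_i)$, and suppose that the symmetry constraint $$F_x=\sum_{i=1}^Nc_iS_i$$ holds. Then: (i) $u=2\sum_{i=1}^Nc_ip_i$, and the functions $p_k$ satisfy the system of hydrodynamic type $$\partial_yp_k=\partial_x\Bigl(p_k^3+6p_k\sum_{i=1}^Nc_ip_i\Bigr),\qquad k=1,\dots,N;$$ (ii) for $z$ near infinity, $z$ and $p=p(z)$ are related by the Sato function $$z=p-\sum_{i=1}^Nc_i\ln\frac{p-p_i}{p+p_i},$$ whose expansion at $p=\infty$ is $z=p+\sum_{n=0}^\infty v_{2n+1}p^{-(2n+1)}$ with $v_{2n+1}=\frac{2}{2n+1}\sum_{i=1}^Nc_ip_i^{2n+1}$; (iii) the functions $p_k$ satisfy the generating system $$\mathcal D(z)p_k=-\partial_x\ln\frac{p-p_k}{p+p_k},\qquad k=1,\dots,N,$$ where $p=p(z)$ is the function of $z,p_1,\dots,p_N$ defined by the relation in (ii), for $z$ near infinity.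
   Context: The B-type quasiclassical vertex operator is $\mathcal D(z)=2\sum_{n=0}^\infty\frac{z^{-(2n+1)}}{2n+1}\frac{\partial}{\partial t_{2n+1}}$, $|z|>1$. A solution of the dispersionless BKP hierarchy is a function $S=S_0+\widetilde S$ with $S_0(z,\mathbf t)=\sum_{n\ge0}t_{2n+1}z^{2n+1}$, $S(-z,\mathbf t)=-S(z,\mathbf t)$, smooth in $\mathbf t$, with $\widetilde S$ analytic in $z$ outside the closed unit disc and $\widetilde S=\sum_{i\ge1}\widetilde S_i(\mathbf t)z^{-i}$ at infinity, such that with $p(z)=\partial_{t_1}S(z)$ $$\frac{p(z_1)-p(z)}{p(z_1)+p(z)}=\exp(-\mathcal D(z_1)S(z)),\qquad z\in\mathbb C,\ |z_1|>1,$$ where, since $\mathcal D(z_1)S_0(z)=\ln\frac{z_1+z}{z_1-z}$ for $|z|<|z_1|$, the right side means $\frac{z_1-z}{z_1+z}e^{-\mathcal D(z_1)\widetilde S(z)}$. Its $\tau$-function $F(\mathbf t)$ is characterized by $\widetilde S(z,\mathbf t)=-\mathcal D(z)F(\mathbf t)$ for $|z|>1$. All series are assumed to converge and to be termwise differentiable. Logarithms $\ln\frac{p-p_i}{p+p_i}$ are the branches vanishing at $p=\infty$. *)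

theory Defs
  imports "HOL-Analysis.Analysis"
begin

text \<open>
  The sequence of times \<open>(t\<^sub>1, t\<^sub>3, t\<^sub>5, \<dots>)\<close> is a function on \<open>nat\<close> whose value at \<open>n\<close> is
  the time with subscript \<open>2n+1\<close>; so \<open>x\<close> has index 0 and \<open>y\<close> has index 1. The set \<open>K\<close> is the
  range of each single time, \<open>\<real>\<close> or all of \<open>\<complex>\<close>; derivatives within \<open>K\<close> are then real or complex
  derivatives of complex-valued functions.
\<close>

type_synonym times = "nat \<Rightarrow> complex"

definition has_tderiv :: "complex set \<Rightarrow> nat \<Rightarrow> (times \<Rightarrow> complex) \<Rightarrow> complex \<Rightarrow> times \<Rightarrow> bool" where
  "has_tderiv K n f d t \<longleftrightarrow> ((\<lambda>s. f (t(n := s))) has_field_derivative d) (at (t n) within K)"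

definition tderiv :: "complex set \<Rightarrow> nat \<Rightarrow> (times \<Rightarrow> complex) \<Rightarrow> times \<Rightarrow> complex" where
  "tderiv K n f t = (THE d. has_tderiv K n f d t)"

definition time_slice :: "complex set \<Rightarrow> times \<Rightarrow> nat \<Rightarrow> times set" where
  "time_slice K t N = {s. (\<forall>n. s n \<in> K) \<and> (\<forall>n\<ge>N. s n = t n)}"

text \<open>
  No nonempty set of times for which \<open>S\<^sub>0\<close> converges is open in the product topology, so openness
  (and below, continuity of the partial derivatives) is required when finitely many times vary;
  on such a slice the product topology is the Euclidean one.
\<close>

definition time_domain :: "complex set \<Rightarrow> times set \<Rightarrow> bool" where
  "time_domain K U \<longleftrightarrow>
     (\<forall>t\<in>U. (\<forall>n. t n \<in> K) \<and>
       (\<forall>N. openin (top_of_set (time_slice K t N)) (U \<inter> time_slice K t N)) \<and>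
       (\<forall>z. summable (\<lambda>n. t n * z ^ (2 * n + 1))))"

definition smooth_in_times :: "complex set \<Rightarrow> times set \<Rightarrow> (times \<Rightarrow> complex) \<Rightarrow> bool" where
  "smooth_in_times K U f \<longleftrightarrow>
     (\<forall>ks. \<forall>t\<in>U.
       (\<forall>n. \<exists>d. has_tderiv K n (foldr (tderiv K) ks f) d t) \<and>
       (\<forall>N. continuous_on (U \<inter> time_slice K t N) (foldr (tderiv K) ks f)))"

definition vertex_coeff :: "complex \<Rightarrow> nat \<Rightarrow> complex" where
  "vertex_coeff z n = 2 * (inverse z ^ (2 * n + 1) / of_nat (2 * n + 1))"

definition vertex_summable :: "complex set \<Rightarrow> complex \<Rightarrow> (times \<Rightarrow> complex) \<Rightarrow> times \<Rightarrow> bool" where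
  "vertex_summable K z f t \<longleftrightarrow> summable (\<lambda>n. vertex_coeff z n * tderiv K n f t)"

definition vertex_op :: "complex set \<Rightarrow> complex \<Rightarrow> (times \<Rightarrow> complex) \<Rightarrow> times \<Rightarrow> complex" where
  "vertex_op K z f t = (\<Sum>n. vertex_coeff z n * tderiv K n f t)"

definition vertex_termwise :: "complex set \<Rightarrow> times set \<Rightarrow> (times \<Rightarrow> complex) \<Rightarrow> bool" where
  "vertex_termwise K U f \<longleftrightarrow>
     (\<forall>z t. norm z > 1 \<longrightarrow> t \<in> U \<longrightarrow>
       vertex_summable K z f t \<and>
       (\<forall>m. summable (\<lambda>n. vertex_coeff z n * tderiv K m (tderiv K n f) t) \<and>
            has_tderiv K m (vertex_op K z f)
              (\<Sum>n. vertex_coeff z n * tderiv K m (tderiv K n f) t) t))"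

definition S_zero :: "complex \<Rightarrow> times \<Rightarrow> complex" where
  "S_zero z t = (\<Sum>n. t n * z ^ (2 * n + 1))"

definition S_tilde :: "(complex \<Rightarrow> times \<Rightarrow> complex) \<Rightarrow> complex \<Rightarrow> times \<Rightarrow> complex" where
  "S_tilde S z t = S z t - S_zero z t"

definition p_fun :: "complex set \<Rightarrow> (complex \<Rightarrow> times \<Rightarrow> complex) \<Rightarrow> complex \<Rightarrow> times \<Rightarrow> complex" where
  "p_fun K S z t = tderiv K 0 (S z) t"

text \<open>
  \<open>a i\<close> is the coefficient of \<open>z\<^sup>-\<^sup>i\<close> in the expansion of \<open>S_tilde S z\<close> at infinity; \<open>a 0\<close> is not
  used. In the hierarchy equation \<open>z = - z\<^sub>1\<close> is left out because both sides have
  a pole there.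
\<close>

definition dBKP_solution ::
    "complex set \<Rightarrow> times set \<Rightarrow> (complex \<Rightarrow> times \<Rightarrow> complex) \<Rightarrow> (nat \<Rightarrow> times \<Rightarrow> complex) \<Rightarrow> bool"
where
  "dBKP_solution K U S a \<longleftrightarrow>
     (\<forall>z. \<forall>t\<in>U. S (- z) t = - S z t) \<and>
     (\<forall>z. smooth_in_times K U (S z)) \<and>
     (\<forall>t\<in>U. (\<lambda>z. S_tilde S z t) holomorphic_on {z. norm z > 1}) \<and>
     (\<forall>t\<in>U. \<forall>\<^sub>F z in at_infinity. (\<lambda>i. a (Suc i) t * inverse z ^ Suc i) sums S_tilde S z t) \<and>
     (\<forall>t\<in>U. \<forall>m. (\<forall>i. \<exists>d. has_tderiv K m (a (Suc i)) d t) \<and>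
        (\<forall>\<^sub>F z in at_infinity.
           (\<lambda>i. tderiv K m (a (Suc i)) t * inverse z ^ Suc i) sums tderiv K m (S_tilde S z) t)) \<and>
     (\<forall>z. vertex_termwise K U (S_tilde S z)) \<and>
     (\<forall>z z1. \<forall>t\<in>U. norm z1 > 1 \<longrightarrow> z \<noteq> - z1 \<longrightarrow>
        (p_fun K S z1 t - p_fun K S z t) / (p_fun K S z1 t + p_fun K S z t) =
        (z1 - z) / (z1 + z) * exp (- vertex_op K z1 (S_tilde S z) t))"

definition tau_function ::
    "complex set \<Rightarrow> times set \<Rightarrow> (complex \<Rightarrow> times \<Rightarrow> complex) \<Rightarrow> (times \<Rightarrow> complex) \<Rightarrow> bool" where
  "tau_function K U S F \<longleftrightarrow>
     smooth_in_times K U F \<and> vertex_termwise K U F \<and>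
     (\<forall>z. \<forall>t\<in>U. norm z > 1 \<longrightarrow> S_tilde S z t = - vertex_op K z F t)"

text \<open>
  For \<open>norm p > norm (q i)\<close> the quotient \<open>(p - q i) / (p + q i)\<close> has positive real part, so there
  the principal branch \<open>Ln\<close> is the branch of the logarithm that vanishes at \<open>p = \<infinity>\<close>.
\<close>

definition sato_log :: "complex \<Rightarrow> complex \<Rightarrow> complex" where
  "sato_log p q = Ln ((p - q) / (p + q))"

definition sato :: "nat \<Rightarrow> (nat \<Rightarrow> complex) \<Rightarrow> (nat \<Rightarrow> complex) \<Rightarrow> complex \<Rightarrow> complex" where
  "sato N c q p = p - (\<Sum>i=1..N. c i * sato_log p (q i))"

definition sato_coeff :: "nat \<Rightarrow> (nat \<Rightarrow> complex) \<Rightarrow> (nat \<Rightarrow> complex) \<Rightarrow> nat \<Rightarrow> complex" where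
  "sato_coeff N c q n = 2 / of_nat (2 * n + 1) * (\<Sum>i=1..N. c i * q i ^ (2 * n + 1))"

text \<open>
  The relation \<open>z = sato N c q p = p + O(1/p)\<close> near infinity determines \<open>p\<close> as a function of \<open>z\<close>
  and \<open>q\<close>: for large \<open>z\<close> every large solution \<open>p\<close> is within distance 1 of \<open>z\<close>, and there is
  exactly one solution there.
\<close>

definition sato_branch ::
    "nat \<Rightarrow> (nat \<Rightarrow> complex) \<Rightarrow> (nat \<Rightarrow> complex) \<Rightarrow> complex \<Rightarrow> complex \<Rightarrow> bool" where
  "sato_branch N c q z p \<longleftrightarrow> norm (p - z) < 1 \<and> z = sato N c q p"

definition sato_inv :: "nat \<Rightarrow> (nat \<Rightarrow> complex) \<Rightarrow> (nat \<Rightarrow> complex) \<Rightarrow> complex \<Rightarrow> complex" where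
  "sato_inv N c q z = (THE p. sato_branch N c q z p)"

end

(*
  By the hierarchy, exp (- D(z) S(\<zeta>)) = (p(z) - p(\<zeta>)) / (p(z) + p(\<zeta>)), and D(z) S(\<zeta>) is a power
  series in 1/z without constant term, so for large z it equals - ln ((p(z) - p(\<zeta>)) / (p(z) + p(\<zeta>)))
  with the branch vanishing at infinity; its z^(-3) coefficient gives \<partial>_y S = p^3 + 3 u p. Since
  mixed partial derivatives commute, applying - D(z) to the constraint turns its left side into
  \<partial>_x of S_tilde(z), that is p(z) - z, which is then - \<Sum> c_i D(z) S_i: this is the Sato relation,
  and its 1/z coefficient gives u. The generating system is \<partial>_x of the formula for D(z) S_k; to
  differentiate it with z fixed one needs that p(z) stays the branch near z of the inverse of the
  Sato function when x varies slightly.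
*)

theory Submission
  imports Defs
begin

subsection \<open>Vertex series and the Sato function near infinity\<close>

lemma eventually_norm_gt: "\<forall>\<^sub>F z in at_infinity. r < norm (z :: 'a :: real_normed_vector)"
  by (rule eventually_at_infinityI[of "r + 1"]) simp

lemma tendsto_0_if_mult_ident_tendsto:
  fixes f :: "'a::real_normed_field \<Rightarrow> 'a"
  assumes "((\<lambda>z. z * f z) \<longlongrightarrow> l) at_infinity"
  shows "(f \<longlongrightarrow> 0) at_infinity"
proof -
  have "((\<lambda>z. inverse z * (z * f z)) \<longlongrightarrow> 0 * l) at_infinity"
    by (intro tendsto_mult assms tendsto_inverse_0)
  moreover have "\<forall>\<^sub>F z in at_infinity. inverse z * (z * f z) = f z"
    using eventually_not_equal_at_infinity[of 0] by eventually_elim simp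
  ultimately show ?thesis
    using Lim_transform_eventually by fastforce
qed

text \<open>In the variable \<open>w = inverse z\<close> this is a power series on a punctured disc,
  so it tends to its constant term. Vertex series contain only odd powers of \<open>1/z\<close>; a
  factor \<open>z\<close> or \<open>z ^ 3\<close> brings them to this even form.\<close>

lemma tendsto_at_infinity_even_power_series:
  fixes f :: "complex \<Rightarrow> complex"
  assumes "\<forall>\<^sub>F z in at_infinity. (\<lambda>n. b n * inverse z ^ (2 * n)) sums f z"
  shows "(f \<longlongrightarrow> b 0) at_infinity"
proof -
  obtain R where R: "\<And>z. R \<le> norm z \<Longrightarrow> (\<lambda>n. b n * inverse z ^ (2 * n)) sums f z"
    using assms by (auto simp: eventually_at_infinity)
  \<comment> \<open>\<open>R\<close> may be zero or negative, hence
    \<open>\<bar>R\<bar> + 1\<close>.\<close>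
  define s where "s = inverse (\<bar>R\<bar> + 1)"
  define d where "d i = (if even i then b (i div 2) else 0)" for i
  have "(\<lambda>i. d i * w ^ i) sums (f \<circ> inverse) w" if "w \<noteq> 0" "norm w < s" for w
  proof -
    have "\<bar>R\<bar> + 1 < norm (inverse w)"
      using that unfolding s_def norm_inverse by (smt (verit) inverse_inverse_eq less_imp_inverse_less norm_eq_zero zero_less_norm_iff)
    then have "(\<lambda>n. d (2 * n) * w ^ (2 * n)) sums (f \<circ> inverse) w"
      using R[of "inverse w"] by (simp add: d_def o_def)
    then show ?thesis
      by (subst (asm) sums_mono_reindex[of "\<lambda>n. 2 * n"])
         (auto simp: strict_mono_def d_def elim: oddE)
  qed
  moreover have "s > 0" by (simp add: s_def)
  ultimately have "((f \<circ> inverse) \<longlongrightarrow> d 0) (at 0)"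
    by (intro powser_limit_0_strong[of s]) auto
  then show ?thesis by (simp add: lim_at_infinity_0 d_def)
qed

lemma tendsto_at_infinity_power_series:
  fixes f :: "complex \<Rightarrow> complex"
  assumes "\<forall>\<^sub>F z in at_infinity. (\<lambda>i. b i * inverse z ^ Suc i) sums f z"
  shows "((\<lambda>z. z * f z) \<longlongrightarrow> b 0) at_infinity"
proof -
  obtain R where R: "\<And>z. R \<le> norm z \<Longrightarrow> (\<lambda>n. b n * inverse z ^ Suc n) sums f z"
    using assms by (auto simp: eventually_at_infinity)
  define s where "s = inverse (\<bar>R\<bar> + 1)"
  have "(\<lambda>i. b i * w ^ i) sums ((\<lambda>z. z * f z) \<circ> inverse) w" if "w \<noteq> 0" "norm w < s" for w
  proof -
    have "\<bar>R\<bar> + 1 < norm (inverse w)"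
      using that unfolding s_def norm_inverse by (smt (verit) inverse_inverse_eq less_imp_inverse_less norm_eq_zero zero_less_norm_iff)
    then have "(\<lambda>n. inverse w * (b n * w ^ Suc n)) sums (inverse w * f (inverse w))"
      using R[of "inverse w"] by (intro sums_mult) simp
    then show ?thesis using that by (simp add: o_def field_simps)
  qed
  moreover have "s > 0" by (simp add: s_def)
  ultimately have "(((\<lambda>z. z * f z) \<circ> inverse) \<longlongrightarrow> b 0) (at 0)"
    by (intro powser_limit_0_strong[of s]) auto
  then show ?thesis by (simp add: lim_at_infinity_0)
qed

section \<open>Leading coefficients of vertex series\<close>

lemma vertex_coeff_0: "vertex_coeff z 0 = 2 / z"
  by (simp add: vertex_coeff_def divide_inverse)

lemma mult_vertex_coeff:
  assumes "z \<noteq> 0"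
  shows "z * vertex_coeff z n = 2 / of_nat (2 * n + 1) * inverse z ^ (2 * n)"
proof -
  have "z * vertex_coeff z n = 2 / of_nat (2 * n + 1) * (z * inverse z ^ (2 * n + 1))"
    unfolding vertex_coeff_def by simp
  then show ?thesis using assms by simp
qed

lemma vertex_series_leading_term:
  assumes "\<forall>\<^sub>F z in at_infinity. (\<lambda>n. vertex_coeff z n * b n) sums V z"
  shows "((\<lambda>z. z * V z) \<longlongrightarrow> 2 * b 0) at_infinity"
proof -
  have "\<forall>\<^sub>F z in at_infinity.
          (\<lambda>n. 2 * b n / of_nat (2 * n + 1) * inverse z ^ (2 * n)) sums (z * V z)"
    using assms eventually_not_equal_at_infinity[of 0]
  proof eventually_elim
    case (elim z)
    have "(\<lambda>n. z * (vertex_coeff z n * b n)) sums (z * V z)"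
      using elim by (intro sums_mult)
    moreover have "z * (vertex_coeff z n * b n) = 2 * b n / of_nat (2 * n + 1) * inverse z ^ (2 * n)" for n
      using mult_vertex_coeff[of z n] elim by (simp add: mult.assoc[symmetric])
    ultimately show ?case by simp
  qed
  from tendsto_at_infinity_even_power_series[OF this] show ?thesis by simp
qed

text \<open>Dropping the term \<open>n = 0\<close>, which is \<open>2 * b 0 / z\<close>, and
  shifting the index leaves an even series after multiplication by \<open>z ^ 3\<close>. This
  isolates the coefficient that carries the derivative in \<open>y\<close>.\<close>

lemma vertex_series_second_term:
  assumes "\<forall>\<^sub>F z in at_infinity. (\<lambda>n. vertex_coeff z n * b n) sums V z"
  shows "((\<lambda>z. z ^ 3 * (V z - 2 * b 0 / z)) \<longlongrightarrow> 2 / 3 * b 1) at_infinity"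
proof -
  have "\<forall>\<^sub>F z in at_infinity.
          (\<lambda>n. 2 * b (Suc n) / of_nat (2 * n + 3) * inverse z ^ (2 * n))
            sums (z ^ 3 * (V z - 2 * b 0 / z))"
    using assms eventually_not_equal_at_infinity[of 0]
  proof eventually_elim
    case (elim z)
    have "(\<lambda>n. vertex_coeff z (Suc n) * b (Suc n)) sums (V z - vertex_coeff z 0 * b 0)"
      using elim by (subst sums_Suc_iff) simp
    then have "(\<lambda>n. z ^ 3 * (vertex_coeff z (Suc n) * b (Suc n))) sums (z ^ 3 * (V z - 2 * b 0 / z))"
      unfolding vertex_coeff_0 by (intro sums_mult) simp
    moreover have "z ^ 3 * (vertex_coeff z (Suc n) * b (Suc n)) =
        2 * b (Suc n) / of_nat (2 * n + 3) * inverse z ^ (2 * n)" for n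
    proof -
      have "z ^ 3 * (vertex_coeff z (Suc n) * b (Suc n)) =
          z\<^sup>2 * (z * vertex_coeff z (Suc n)) * b (Suc n)"
        by (simp add: power2_eq_square power3_eq_cube)
      also have "\<dots> = 2 * b (Suc n) / of_nat (2 * n + 3) * (z\<^sup>2 * inverse z ^ (2 * Suc n))"
        using elim by (simp add: mult_vertex_coeff add.commute)
      also have "z\<^sup>2 * inverse z ^ (2 * Suc n) = inverse z ^ (2 * n)"
        using elim by (simp add: power2_eq_square field_simps)
      finally show ?thesis .
    qed
    ultimately show ?case by simp
  qed
  from tendsto_at_infinity_even_power_series[OF this] show ?thesis by simp
qed

section \<open>The logarithm of \<open>(P - q) / (P + q)\<close> and the Sato function\<close>

lemma Re_sato_quotient_pos:
  assumes "norm q < norm P"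
  shows "Re ((P - q) / (P + q)) > 0"
proof -
  have "(norm q)\<^sup>2 < (norm P)\<^sup>2"
    using assms by (simp add: power_strict_mono)
  \<comment> \<open>The quotient and this product have real parts of the same sign, and that of the
    product is \<open>(norm P)\<^sup>2 - (norm q)\<^sup>2\<close>. So the argument of
    \<open>Ln\<close> stays off the branch cut.\<close>
  then have "0 < Re ((P - q) * cnj (P + q))"
    by (simp add: cmod_power2) (simp add: algebra_simps power2_eq_square)
  then show ?thesis by (simp only: Re_complex_div_gt_0)
qed

lemma add_nonzero_if_norm_less:
  fixes P q :: complex
  assumes "norm q < norm P"
  shows "P + q \<noteq> 0" "P - q \<noteq> 0"
  using assms by (auto simp: add_eq_0_iff2)

text \<open>With \<open>w = q / P\<close> this is the expansion of
  \<open>Ln (1 + w) - Ln (1 - w)\<close>, in which the even powers cancel. It also evaluates the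
  vertex series of \<open>S_zero q\<close>, whose time derivatives are
  \<open>q ^ (2 * n + 1)\<close>.\<close>

lemma sato_log_sums:
  assumes "norm q < norm P"
  shows "(\<lambda>n. vertex_coeff P n * q ^ (2 * n + 1)) sums (- sato_log P q)"
proof -
  define w where "w = q / P"
  have P: "P \<noteq> 0" using assms by auto
  have w: "norm w < 1" using assms P by (simp add: w_def norm_divide)
  have abs_Re: "\<bar>Re w\<bar> < 1" using w abs_Re_le_cmod[of w] by linarith
  \<comment> \<open>Two imaginary parts below \<open>pi / 2\<close> have a difference below
    \<open>pi\<close>, so \<open>Ln\<close> of the quotient splits without a multiple of
    \<open>2 * pi * \<i>\<close>.\<close>
  have Im: "\<bar>Im (Ln (1 - w))\<bar> < pi / 2" "\<bar>Im (Ln (1 + w))\<bar> < pi / 2"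
    using abs_Re by (intro Re_Ln_pos_lt_imp; simp)+
  have nz: "1 + w \<noteq> 0" "1 - w \<noteq> 0"
    using w by (auto simp: add_eq_0_iff)
  have "(P - q) / (P + q) = (1 - w) / (1 + w)"
    using P add_nonzero_if_norm_less[OF assms] nz by (simp add: w_def divide_simps)
  also have "Ln \<dots> = Ln (1 - w) - Ln (1 + w)"
    using Im nz by (intro Ln_unique) (simp_all add: exp_diff)
  finally have log: "- sato_log P q = Ln (1 + w) - Ln (1 - w)"
    by (simp add: sato_log_def)
  have "(\<lambda>n. - ((- w) ^ n) / of_nat n - - ((- (- w)) ^ n) / of_nat n) sums (Ln (1 + w) - Ln (1 + - w))"
    using w by (intro sums_diff Ln_series') auto
  then have "(\<lambda>n. (w ^ n - (- w) ^ n) / of_nat n) sums (- sato_log P q)"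
    by (simp add: log diff_divide_distrib)
  then have "(\<lambda>n. (w ^ (2 * n + 1) - (- w) ^ (2 * n + 1)) / of_nat (2 * n + 1)) sums (- sato_log P q)"
  proof (subst sums_mono_reindex[of "\<lambda>n. 2 * n + 1"])
    fix n :: nat assume "n \<notin> range (\<lambda>n. 2 * n + 1)"
    then have "even n" by (metis oddE rangeI)
    then show "(w ^ n - (- w) ^ n) / of_nat n = 0" by simp
  qed (auto simp: strict_mono_def)
  then show ?thesis
    using P by (simp add: vertex_coeff_def w_def power_divide divide_simps)
qed

lemma has_field_derivative_sato_log:
  assumes "norm q < norm P"
  shows "((\<lambda>P. sato_log P q) has_field_derivative 2 * q / (P\<^sup>2 - q\<^sup>2)) (at P within A)"
proof -
  have "(P - q) / (P + q) \<notin> \<real>\<^sub>\<le>\<^sub>0"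
    using Re_sato_quotient_pos[OF assms] by (auto simp: complex_nonpos_Reals_iff)
  moreover note nz = add_nonzero_if_norm_less[OF assms]
  moreover have "P\<^sup>2 - q\<^sup>2 = (P + q) * (P - q)" by (simp add: algebra_simps power2_eq_square)
  ultimately show ?thesis
    unfolding sato_log_def
    by (auto intro!: derivative_eq_intros simp: divide_simps)
qed

text \<open>On the ball all points have norm at least \<open>r > M\<close>, which bounds the
  derivative. The constant is uniform in \<open>q\<close> and tends to 0 as \<open>r\<close>
  grows.\<close>

lemma sato_log_lipschitz:
  assumes M: "0 \<le> M" "norm q \<le> M" and r: "M < r" and z: "r + 1 \<le> norm z"
    and PQ: "P \<in> ball z 1" "Q \<in> ball z 1"
  shows "norm (sato_log P q - sato_log Q q) \<le> 2 * M / (r\<^sup>2 - M\<^sup>2) * norm (P - Q)"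
proof (rule field_differentiable_bound[OF convex_ball _ _ PQ])
  fix x assume "x \<in> ball z 1"
  then have x: "r \<le> norm x" using z norm_triangle_ineq2[of z x] by (simp add: dist_norm)
  then show "((\<lambda>P. sato_log P q) has_field_derivative 2 * q / (x\<^sup>2 - q\<^sup>2)) (at x within ball z 1)"
    using M r by (intro has_field_derivative_sato_log) linarith
  have "r\<^sup>2 - M\<^sup>2 \<le> (norm x)\<^sup>2 - (norm q)\<^sup>2"
    using x M r by (intro diff_mono power_mono) auto
  also have "\<dots> \<le> norm (x\<^sup>2 - q\<^sup>2)"
    using norm_triangle_ineq2[of "x\<^sup>2" "q\<^sup>2"] by (simp add: norm_power)
  finally have "r\<^sup>2 - M\<^sup>2 \<le> norm (x\<^sup>2 - q\<^sup>2)" .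
  moreover have "M\<^sup>2 < r\<^sup>2" using M r by (simp add: power_strict_mono)
  ultimately show "norm (2 * q / (x\<^sup>2 - q\<^sup>2)) \<le> 2 * M / (r\<^sup>2 - M\<^sup>2)"
    using M by (auto simp: norm_divide norm_mult intro!: frac_le)
qed

lemma sato_expansion:
  "\<forall>\<^sub>F P in at_infinity.
     (\<lambda>n. sato_coeff N c q n * inverse P ^ (2 * n + 1)) sums (sato N c q P - P)"
proof -
  have "\<forall>\<^sub>F P in at_infinity. \<forall>i\<in>{1..N}. norm (q i) < norm (P :: complex)"
    by (intro eventually_ball_finite ballI eventually_norm_gt) simp
  then show ?thesis
  proof eventually_elim
    case (elim P)
    then have "(\<lambda>n. \<Sum>i=1..N. c i * (vertex_coeff P n * q i ^ (2 * n + 1)))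
        sums (\<Sum>i=1..N. c i * - sato_log P (q i))"
      by (intro sums_sum sums_mult sato_log_sums) simp
    then show ?case
      by (simp add: sato_def sato_coeff_def vertex_coeff_def sum_negf sum_distrib_left sum_distrib_right
          sum_divide_distrib mult_ac)
  qed
qed

text \<open>Uniform in \<open>q\<close>, so that the branch can be followed when the times vary with \<open>z\<close> fixed.\<close>

lemma sato_branch_unique:
  assumes M: "0 \<le> M"
  shows "\<forall>\<^sub>F z in at_infinity. \<forall>q P Q. (\<forall>i\<in>{1..N}. norm (q i) \<le> M) \<longrightarrow>
           sato_branch N c q z P \<longrightarrow> sato_branch N c q z Q \<longrightarrow> P = Q"
proof -
  define C where "C = (\<Sum>i=1..N. norm (c i))"
  \<comment> \<open>Here \<open>r - M = 1 + 4 * C * M\<close> and \<open>r + M \<ge> 1\<close>, so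
    the total Lipschitz constant \<open>2 * C * M / (r\<^sup>2 - M\<^sup>2)\<close> below is at most
    \<open>1 / 2\<close>.\<close>
  define r where "r = M + 1 + 4 * C * M"
  have C: "0 \<le> C" by (simp add: C_def sum_nonneg)
  have Mr: "M < r" using M C by (simp add: r_def add_pos_nonneg)
  have "4 * C * M + 1 \<le> (r - M) * (r + M)"
    using M C mult_mono[of "4 * C * M + 1" "r - M" 1 "r + M"] by (simp add: r_def)
  then have rM: "4 * C * M + 1 \<le> r\<^sup>2 - M\<^sup>2" by (simp add: power2_eq_square algebra_simps)
  have "P = Q"
    if z: "r + 1 \<le> norm z" and q: "\<And>i. i \<in> {1..N} \<Longrightarrow> norm (q i) \<le> M"
      and P: "sato_branch N c q z P" and Q: "sato_branch N c q z Q" for z q P Q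
  proof -
    have ball: "P \<in> ball z 1" "Q \<in> ball z 1"
      using P Q by (auto simp: sato_branch_def dist_norm norm_minus_commute)
    \<comment> \<open>Both solutions are fixed points of one map that has Lipschitz constant
      \<open>1 / 2\<close> on the unit ball around \<open>z\<close>, so they coincide.\<close>
    have "P = z + (\<Sum>i=1..N. c i * sato_log P (q i))" "Q = z + (\<Sum>i=1..N. c i * sato_log Q (q i))"
      using P Q by (auto simp add: sato_branch_def sato_def diff_eq_eq eq_diff_eq)
    then have "P - Q = (\<Sum>i=1..N. c i * (sato_log P (q i) - sato_log Q (q i)))"
      unfolding right_diff_distrib sum_subtractf by (metis add_diff_cancel_left)
    also have "norm \<dots> \<le> (\<Sum>i=1..N. norm (c i) * (2 * M / (r\<^sup>2 - M\<^sup>2) * norm (P - Q)))"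
      by (intro sum_norm_le, unfold norm_mult)
         (intro mult_left_mono sato_log_lipschitz[OF M q Mr z ball] norm_ge_zero)
    also have "\<dots> = 2 * C * M / (r\<^sup>2 - M\<^sup>2) * norm (P - Q)"
      by (simp add: C_def sum_distrib_left sum_distrib_right sum_divide_distrib mult_ac)
    also have "\<dots> \<le> 1 / 2 * norm (P - Q)"
    proof (intro mult_right_mono norm_ge_zero)
      have "0 < r\<^sup>2 - M\<^sup>2" using rM C M by (smt (verit) mult_nonneg_nonneg)
      then show "2 * C * M / (r\<^sup>2 - M\<^sup>2) \<le> 1 / 2"
        using rM by (simp add: pos_divide_le_eq)
    qed
    finally show "P = Q" by simp
  qed
  then show ?thesis by (intro eventually_at_infinityI[of "r + 1"]) blast
qed

subsection \<open>Partial derivatives with respect to the times\<close>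

locale times_domain =
  fixes K :: "complex set" and U :: "times set"
  assumes K: "K = \<real> \<or> K = UNIV"
    and U: "time_domain K U"
begin

lemma convex_K: "convex K"
  using K convex_Reals by auto

text \<open>A connected set with more than one point has no isolated points. This makes derivatives
  within \<open>K\<close> unique.\<close>

lemma at_within_K: "x \<in> K \<Longrightarrow> at x within K \<noteq> bot"
proof -
  assume "x \<in> K"
  moreover have "0 \<in> K" "1 \<in> K" using K by auto
  then have "K \<noteq> {y}" for y by (metis singletonD zero_neq_one)
  ultimately show ?thesis
    using connected_imp_perfect[OF convex_connected[OF convex_K]]
    by (simp add: trivial_limit_within)
qed

lemma add_of_real_mem_K: "x \<in> K \<Longrightarrow> x + of_real r \<in> K"
  using K by auto

lemma times_mem_K: "t \<in> U \<Longrightarrow> t n \<in> K"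
  using U by (simp add: time_domain_def)

lemma times_summable: "t \<in> U \<Longrightarrow> summable (\<lambda>n. t n * z ^ (2 * n + 1))"
  using U by (simp add: time_domain_def)

lemma has_tderiv_unique:
  assumes "t \<in> U" "has_tderiv K n f d t" "has_tderiv K n f d' t"
  shows "d = d'"
  using assms has_field_derivative_unique at_within_K times_mem_K
  unfolding has_tderiv_def by blast

lemma tderiv_eq: "t \<in> U \<Longrightarrow> has_tderiv K n f d t \<Longrightarrow> tderiv K n f t = d"
  unfolding tderiv_def using has_tderiv_unique by blast

text \<open>The two times \<open>m\<close> and \<open>n\<close> may vary at once; \<open>m = n\<close> gives a neighbourhood in a single time.\<close>

lemma rectangle_subset_preimage:
  assumes t: "t \<in> U" and V: "\<And>N. \<exists>T. open T \<and> t \<in> T \<and> U \<inter> time_slice K t N \<inter> T \<subseteq> V"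
  obtains e where "e > 0"
    "\<And>s w. s \<in> K \<inter> ball (t m) e \<Longrightarrow> w \<in> K \<inter> ball (t n) e \<Longrightarrow> t(m := s, n := w) \<in> U \<inter> V"
proof -
  \<comment> \<open>A slice freezes all times of index \<open>N\<close> or more, so \<open>N\<close>
    has to exceed both \<open>m\<close> and \<open>n\<close>.\<close>
  define N where "N = Suc (max m n)"
  have "openin (top_of_set (time_slice K t N)) (U \<inter> time_slice K t N)"
    using U t by (simp add: time_domain_def)
  then obtain T1 where T1: "open T1" "U \<inter> time_slice K t N = time_slice K t N \<inter> T1"
    unfolding openin_open by metis
  obtain T2 where T2: "open T2" "t \<in> T2" "U \<inter> time_slice K t N \<inter> T2 \<subseteq> V"
    using V by blast
  let ?h = "\<lambda>x. t(m := fst x, n := snd x)"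
  have "continuous_on UNIV (\<lambda>x. ?h x i)" for i
    by (cases "i = n"; cases "i = m") (auto intro!: continuous_intros)
  then have "continuous_on UNIV ?h"
    by (intro continuous_on_coordinatewise_then_product)
  then have "open (?h -` (T1 \<inter> T2))"
    using T1 T2 by (intro open_vimage open_Int)
  moreover have "t \<in> time_slice K t N"
    using t times_mem_K by (simp add: time_slice_def)
  then have "t \<in> T1 \<inter> T2" using t T1(2) T2(2) by blast
  then have "(t m, t n) \<in> ?h -` (T1 \<inter> T2)" by simp
  ultimately obtain A B where AB: "open A" "open B" "t m \<in> A" "t n \<in> B" "A \<times> B \<subseteq> ?h -` (T1 \<inter> T2)"
    by (elim open_prod_elim) auto
  obtain e1 e2 where e: "e1 > 0" "e2 > 0" "ball (t m) e1 \<subseteq> A" "ball (t n) e2 \<subseteq> B"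
    using AB open_contains_ball by metis
  show ?thesis
  proof (rule that[of "min e1 e2"])
    fix s w assume "s \<in> K \<inter> ball (t m) (min e1 e2)" "w \<in> K \<inter> ball (t n) (min e1 e2)"
    then have sw: "s \<in> K" "w \<in> K" "(s, w) \<in> A \<times> B" using e by auto
    then have "?h (s, w) \<in> T1 \<inter> T2" using AB by blast
    moreover have "?h (s, w) \<in> time_slice K t N"
      using sw t times_mem_K by (auto simp: time_slice_def N_def)
    ultimately show "t(m := s, n := w) \<in> U \<inter> V"
      using T1(2) T2(3) by auto
  qed (use e in auto)
qed

text \<open>This allows identities that hold on \<open>U\<close> to be differentiated in a single
  time.\<close>

lemma eventually_line_mem:
  assumes "t \<in> U"
  shows "\<forall>\<^sub>F s in at (t n) within K. t(n := s) \<in> U"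
proof -
  obtain e where "e > 0" "\<And>s w. s \<in> K \<inter> ball (t n) e \<Longrightarrow> w \<in> K \<inter> ball (t n) e \<Longrightarrow> t(n := s, n := w) \<in> U \<inter> UNIV"
    using rectangle_subset_preimage[OF assms, of UNIV n n] by blast
  then show ?thesis
    unfolding eventually_at by (intro exI[of _ e]) (auto simp: dist_commute)
qed

lemma has_tderiv_cong_eventually:
  assumes "\<forall>\<^sub>F s in at (t n) within K. f (t(n := s)) = g (t(n := s))" "f t = g t"
  shows "has_tderiv K n f d t \<longleftrightarrow> has_tderiv K n g d t"
  unfolding has_tderiv_def using assms by (intro has_field_derivative_cong_eventually) auto

lemma has_tderiv_cong:
  assumes "t \<in> U" "\<And>t. t \<in> U \<Longrightarrow> f t = g t"
  shows "has_tderiv K n f d t \<longleftrightarrow> has_tderiv K n g d t"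
  by (intro has_tderiv_cong_eventually eventually_mono[OF eventually_line_mem[OF assms(1)]] assms)

lemma tderiv_cong:
  assumes "t \<in> U" "\<And>t. t \<in> U \<Longrightarrow> f t = g t"
  shows "tderiv K n f t = tderiv K n g t"
  unfolding tderiv_def using has_tderiv_cong[OF assms] by simp

lemma has_tderiv_tendsto:
  assumes "has_tderiv K n f d t"
  shows "((\<lambda>s. f (t(n := s))) \<longlongrightarrow> f t) (at (t n) within K)"
proof -
  have "continuous (at (t n) within K) (\<lambda>s. f (t(n := s)))"
    using assms unfolding has_tderiv_def by (rule DERIV_continuous)
  then show ?thesis by (simp add: continuous_within)
qed

section \<open>Smooth functions and the symmetry of mixed derivatives\<close>

lemma smooth_has_tderiv:
  assumes "smooth_in_times K U f" "t \<in> U"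
  shows "has_tderiv K n f (tderiv K n f t) t"
proof -
  obtain d where "has_tderiv K n f d t"
    using assms unfolding smooth_in_times_def by (metis foldr.simps(1) id_apply)
  then show ?thesis using tderiv_eq[OF assms(2)] by metis
qed

lemma smooth_tderiv:
  assumes "smooth_in_times K U f"
  shows "smooth_in_times K U (tderiv K n f)"
  unfolding smooth_in_times_def
proof (intro allI ballI)
  fix ks t assume "t \<in> U"
  then show "(\<forall>m. \<exists>d. has_tderiv K m (foldr (tderiv K) ks (tderiv K n f)) d t) \<and>
      (\<forall>N. continuous_on (U \<inter> time_slice K t N) (foldr (tderiv K) ks (tderiv K n f)))"
    \<comment> \<open>\<open>foldr\<close> applies the last list entry first, so appending
      \<open>n\<close> puts that derivative next to \<open>f\<close>.\<close>
    using assms[unfolded smooth_in_times_def, rule_format, of t "ks @ [n]"] by simp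
qed

lemma smooth_continuous_on:
  assumes "smooth_in_times K U f" "t \<in> U"
  shows "continuous_on (U \<inter> time_slice K t N) f"
  using assms[unfolded smooth_in_times_def] by (metis foldr.simps(1) id_apply)

text \<open>The mean value inequality is applied twice: in \<open>w\<close> to
  \<open>tderiv K m f\<close>, then in \<open>s\<close> to the difference of \<open>f\<close>
  between \<open>w\<close> and \<open>t n\<close>. Subtracting the bilinear term first leaves a
  mixed derivative of norm at most \<open>\<epsilon>\<close>. Convexity of \<open>K\<close> covers
  the real and the complex case together.\<close>

lemma second_difference_bound:
  assumes f: "smooth_in_times K U f" and t: "t \<in> U" and mn: "m \<noteq> n"
    and rect: "\<And>s w. s \<in> K \<inter> ball (t m) e \<Longrightarrow> w \<in> K \<inter> ball (t n) e \<Longrightarrow> t(m := s, n := w) \<in> U \<and>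
        norm (tderiv K n (tderiv K m f) (t(m := s, n := w)) - A) \<le> \<epsilon>"
    and s: "s \<in> K \<inter> ball (t m) e" and w: "w \<in> K \<inter> ball (t n) e"
  shows "norm (f (t(m := s, n := w)) - f (t(m := s)) - f (t(n := w)) + f t - (s - t m) * (w - t n) * A)
           \<le> \<epsilon> * norm (s - t m) * norm (w - t n)"
proof -
  let ?g = "\<lambda>s w. f (t(m := s, n := w))"
  let ?g1 = "\<lambda>s w. tderiv K m f (t(m := s, n := w))"
  let ?g2 = "\<lambda>s w. tderiv K n (tderiv K m f) (t(m := s, n := w))"
  let ?I = "K \<inter> ball (t m) e" and ?J = "K \<inter> ball (t n) e"
  have e: "e > 0" using s by (auto intro: le_less_trans[OF zero_le_dist])
  have t_mem: "t m \<in> ?I" "t n \<in> ?J" using e t times_mem_K by auto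
  have convex: "convex ?I" "convex ?J" using convex_K by (auto intro: convex_Int)
  have g1: "((\<lambda>s. ?g s w) has_field_derivative ?g1 s w) (at s within ?I)" if "s \<in> ?I" "w \<in> ?J" for s w
    using smooth_has_tderiv[OF f, of "t(m := s, n := w)" m] rect[OF that] mn
    unfolding has_tderiv_def
    by (auto simp: fun_upd_twist intro: has_field_derivative_subset)
  have g2: "(?g1 s has_field_derivative ?g2 s w) (at w within ?J)" if "s \<in> ?I" "w \<in> ?J" for s w
    using smooth_has_tderiv[OF smooth_tderiv[OF f], of "t(m := s, n := w)" n m] rect[OF that] mn
    unfolding has_tderiv_def
    by (auto intro: has_field_derivative_subset)
  have inner: "norm (?g1 s w - ?g1 s (t n) - (w - t n) * A) \<le> \<epsilon> * norm (w - t n)" if "s \<in> ?I" for s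
  proof -
    have "norm ((?g1 s w - w * A) - (?g1 s (t n) - t n * A)) \<le> \<epsilon> * norm (w - t n)"
    proof (rule field_differentiable_bound[OF convex(2) _ _ w t_mem(2)])
      fix v assume "v \<in> ?J"
      then show "((\<lambda>w. ?g1 s w - w * A) has_field_derivative ?g2 s v - A) (at v within ?J)"
        using that by (auto intro!: derivative_eq_intros g2)
      show "norm (?g2 s v - A) \<le> \<epsilon>" using rect[OF that \<open>v \<in> ?J\<close>] by blast
    qed
    then show ?thesis by (simp add: algebra_simps)
  qed
  have "norm ((?g s w - ?g s (t n) - s * ((w - t n) * A)) - (?g (t m) w - ?g (t m) (t n) - t m * ((w - t n) * A)))
          \<le> \<epsilon> * norm (w - t n) * norm (s - t m)"
  proof (rule field_differentiable_bound[OF convex(1) _ _ s t_mem(1)])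
    fix r assume r: "r \<in> ?I"
    then show "((\<lambda>s. ?g s w - ?g s (t n) - s * ((w - t n) * A)) has_field_derivative
                 ?g1 r w - ?g1 r (t n) - (w - t n) * A) (at r within ?I)"
      using w t_mem by (auto intro!: derivative_eq_intros g1)
    show "norm (?g1 r w - ?g1 r (t n) - (w - t n) * A) \<le> \<epsilon> * norm (w - t n)" by (rule inner[OF r])
  qed
  moreover have "t(m := s, n := t n) = t(m := s)" using mn by auto
  ultimately show ?thesis by (simp add: algebra_simps)
qed

text \<open>Schwarz's theorem. The second difference over a square of side \<open>\<delta>\<close>
  is within \<open>\<epsilon> / 2 * \<delta> * \<delta>\<close> of both
  \<open>\<delta> * \<delta> * A\<close> and \<open>\<delta> * \<delta> * B\<close>; dividing by
  \<open>\<delta> * \<delta>\<close> gives \<open>norm (A - B) \<le> \<epsilon>\<close>.\<close>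

lemma tderiv_commute:
  assumes f: "smooth_in_times K U f" and t: "t \<in> U"
  shows "tderiv K m (tderiv K n f) t = tderiv K n (tderiv K m f) t"
proof (cases "m = n")
  case mn: False
  define A where "A = tderiv K n (tderiv K m f) t"
  define B where "B = tderiv K m (tderiv K n f) t"
  have "norm (A - B) \<le> \<epsilon>" if \<epsilon>: "\<epsilon> > 0" for \<epsilon>
  proof -
    have neighbourhood: "\<exists>T. open T \<and> t \<in> T \<and> U \<inter> time_slice K t N \<inter> T \<subseteq> {t'. norm (h t' - h t) \<le> \<epsilon> / 2}"
      if h: "smooth_in_times K U h" for h N
    proof -
      have "openin (top_of_set (U \<inter> time_slice K t N)) (U \<inter> time_slice K t N \<inter> h -` ball (h t) (\<epsilon> / 2))"
        using smooth_continuous_on[OF h t] by (intro continuous_openin_preimage_gen) auto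
      then obtain T where T: "open T" "U \<inter> time_slice K t N \<inter> h -` ball (h t) (\<epsilon> / 2) = U \<inter> time_slice K t N \<inter> T"
        unfolding openin_open by blast
      have "t \<in> U \<inter> time_slice K t N \<inter> h -` ball (h t) (\<epsilon> / 2)"
        using t times_mem_K \<epsilon> by (simp add: time_slice_def)
      then have "t \<in> T" using T by blast
      moreover have "norm (h t' - h t) \<le> \<epsilon> / 2" if "t' \<in> U \<inter> time_slice K t N \<inter> T" for t'
        using that unfolding T(2)[symmetric] by (simp add: dist_norm norm_minus_commute)
      ultimately show ?thesis
        using T(1) by blast
    qed
    note fA = smooth_tderiv[OF smooth_tderiv[OF f], of n m]
    note fB = smooth_tderiv[OF smooth_tderiv[OF f], of m n]
    obtain e1 where e1: "e1 > 0" "\<And>s w. s \<in> K \<inter> ball (t m) e1 \<Longrightarrow> w \<in> K \<inter> ball (t n) e1 \<Longrightarrow>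
        t(m := s, n := w) \<in> U \<inter> {t'. norm (tderiv K n (tderiv K m f) t' - A) \<le> \<epsilon> / 2}"
      using rectangle_subset_preimage[OF t neighbourhood[OF fA]] unfolding A_def by blast
    obtain e2 where e2: "e2 > 0" "\<And>s w. s \<in> K \<inter> ball (t n) e2 \<Longrightarrow> w \<in> K \<inter> ball (t m) e2 \<Longrightarrow>
        t(n := s, m := w) \<in> U \<inter> {t'. norm (tderiv K m (tderiv K n f) t' - B) \<le> \<epsilon> / 2}"
      using rectangle_subset_preimage[OF t neighbourhood[OF fB]] unfolding B_def by blast
    define \<delta> where "\<delta> = min e1 e2 / 2"
    have \<delta>: "0 < \<delta>" "\<delta> < e1" "\<delta> < e2" using e1 e2 by (auto simp: \<delta>_def)
    define s where "s = t m + of_real \<delta>"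
    define w where "w = t n + of_real \<delta>"
    define D where "D = f (t(m := s, n := w)) - f (t(m := s)) - f (t(n := w)) + f t"
    have mem: "s \<in> K \<inter> ball (t m) e1" "w \<in> K \<inter> ball (t n) e1" "s \<in> K \<inter> ball (t m) e2" "w \<in> K \<inter> ball (t n) e2"
      using \<delta> t times_mem_K add_of_real_mem_K by (auto simp: s_def w_def dist_norm)
    have "norm (D - of_real \<delta> * of_real \<delta> * A) \<le> \<epsilon> / 2 * \<delta> * \<delta>"
      using second_difference_bound[OF f t mn _ mem(1,2), of A "\<epsilon> / 2"] e1(2) \<delta>
      by (simp add: s_def w_def D_def)
    \<comment> \<open>\<open>D\<close> is symmetric in the two times, so the bound applies with
      \<open>m\<close> and \<open>n\<close> exchanged.\<close>
    moreover have "norm (D - of_real \<delta> * of_real \<delta> * B) \<le> \<epsilon> / 2 * \<delta> * \<delta>"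
      using second_difference_bound[OF f t mn[symmetric] _ mem(4,3), of B "\<epsilon> / 2"] e2(2) \<delta>
      by (simp add: s_def w_def D_def fun_upd_twist[OF mn] algebra_simps)
    ultimately have "norm ((D - of_real \<delta> * of_real \<delta> * B) - (D - of_real \<delta> * of_real \<delta> * A)) \<le> \<epsilon> * (\<delta> * \<delta>)"
      using norm_triangle_ineq4[of "D - of_real \<delta> * of_real \<delta> * B" "D - of_real \<delta> * of_real \<delta> * A"]
      by (simp add: algebra_simps)
    also have "(D - of_real \<delta> * of_real \<delta> * B) - (D - of_real \<delta> * of_real \<delta> * A) = of_real (\<delta> * \<delta>) * (A - B)"
      by (simp add: algebra_simps)
    finally have "(\<delta> * \<delta>) * norm (A - B) \<le> (\<delta> * \<delta>) * \<epsilon>"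
      using \<delta> by (simp add: norm_mult mult.commute)
    then show ?thesis using \<delta> by simp
  qed
  then have "A = B" by (metis dense_ge eq_iff_diff_eq_0 norm_le_zero_iff)
  then show ?thesis by (simp add: A_def B_def)
qed simp

end

subsection \<open>Solutions of the hierarchy\<close>

locale dBKP = times_domain +
  fixes S :: "complex \<Rightarrow> times \<Rightarrow> complex" and a :: "nat \<Rightarrow> times \<Rightarrow> complex"
  assumes S: "dBKP_solution K U S a"
begin

lemma smooth_S: "smooth_in_times K U (S \<zeta>)"
  using S by (simp add: dBKP_solution_def)

lemma vertex_termwise_S_tilde: "vertex_termwise K U (S_tilde S \<zeta>)"
  using S by (simp add: dBKP_solution_def)

lemma hierarchy:
  "t \<in> U \<Longrightarrow> norm z > 1 \<Longrightarrow> \<zeta> \<noteq> - z \<Longrightarrow>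
     (p_fun K S z t - p_fun K S \<zeta> t) / (p_fun K S z t + p_fun K S \<zeta> t) =
     (z - \<zeta>) / (z + \<zeta>) * exp (- vertex_op K z (S_tilde S \<zeta>) t)"
  using S by (simp add: dBKP_solution_def)

lemma has_tderiv_S: "t \<in> U \<Longrightarrow> has_tderiv K n (S \<zeta>) (tderiv K n (S \<zeta>) t) t"
  by (rule smooth_has_tderiv[OF smooth_S])

lemma p_fun_eq: "p_fun K S \<zeta> = tderiv K 0 (S \<zeta>)"
  by (simp add: p_fun_def fun_eq_iff)

lemma has_tderiv_p_fun: "t \<in> U \<Longrightarrow> has_tderiv K n (p_fun K S \<zeta>) (tderiv K n (p_fun K S \<zeta>) t) t"
  unfolding p_fun_eq by (rule smooth_has_tderiv[OF smooth_tderiv[OF smooth_S]])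

section \<open>Time derivatives of \<open>S_zero\<close> and \<open>S_tilde\<close>\<close>

lemma has_tderiv_S_zero:
  assumes t: "t \<in> U"
  shows "has_tderiv K n (S_zero \<zeta>) (\<zeta> ^ (2 * n + 1)) t"
proof -
  \<comment> \<open>Changing one time changes one term of the series, so \<open>S_zero\<close> is
    affine in that time.\<close>
  have "S_zero \<zeta> (t(n := s)) = S_zero \<zeta> t + (s - t n) * \<zeta> ^ (2 * n + 1)" for s
  proof -
    have "(\<lambda>i. t i * \<zeta> ^ (2 * i + 1)) sums S_zero \<zeta> t"
      unfolding S_zero_def by (intro summable_sums times_summable t)
    moreover have "(\<lambda>i. if i = n then (s - t n) * \<zeta> ^ (2 * n + 1) else 0) sums ((s - t n) * \<zeta> ^ (2 * n + 1))"
      by (rule sums_single)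
    ultimately have "(\<lambda>i. t i * \<zeta> ^ (2 * i + 1) + (if i = n then (s - t n) * \<zeta> ^ (2 * n + 1) else 0))
        sums (S_zero \<zeta> t + (s - t n) * \<zeta> ^ (2 * n + 1))"
      by (rule sums_add)
    also have "(\<lambda>i. t i * \<zeta> ^ (2 * i + 1) + (if i = n then (s - t n) * \<zeta> ^ (2 * n + 1) else 0)) =
        (\<lambda>i. (t(n := s)) i * \<zeta> ^ (2 * i + 1))"
      by (auto simp: fun_eq_iff algebra_simps)
    finally show ?thesis unfolding S_zero_def by (rule sums_unique[symmetric])
  qed
  then show ?thesis
    unfolding has_tderiv_def by (auto intro!: derivative_eq_intros)
qed

lemma has_tderiv_S_tilde:
  assumes t: "t \<in> U"
  shows "has_tderiv K n (S_tilde S \<zeta>) (tderiv K n (S \<zeta>) t - \<zeta> ^ (2 * n + 1)) t"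
  using DERIV_diff[OF has_tderiv_S[OF t, unfolded has_tderiv_def] has_tderiv_S_zero[OF t, unfolded has_tderiv_def]]
  unfolding has_tderiv_def S_tilde_def .

lemma tderiv_S_tilde:
  "t \<in> U \<Longrightarrow> tderiv K n (S_tilde S \<zeta>) t = tderiv K n (S \<zeta>) t - \<zeta> ^ (2 * n + 1)"
  by (rule tderiv_eq[OF _ has_tderiv_S_tilde])

text \<open>First derivatives of \<open>S_zero\<close> do not depend on the times, so second
  derivatives see only \<open>S\<close>, where they commute. For \<open>m = 0\<close> the right side
  is a derivative of \<open>p_fun\<close>, so the \<open>x\<close>-derivative of a vertex series of
  \<open>S_tilde\<close> is a vertex series of \<open>p_fun\<close>.\<close>

lemma tderiv_tderiv_S_tilde:
  assumes t: "t \<in> U"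
  shows "tderiv K m (tderiv K n (S_tilde S \<zeta>)) t = tderiv K n (tderiv K m (S \<zeta>)) t"
proof -
  have "has_tderiv K m (\<lambda>t. tderiv K n (S \<zeta>) t - \<zeta> ^ (2 * n + 1)) (tderiv K m (tderiv K n (S \<zeta>)) t) t"
    using smooth_has_tderiv[OF smooth_tderiv[OF smooth_S] t]
    unfolding has_tderiv_def by (auto intro!: derivative_eq_intros)
  then have "has_tderiv K m (tderiv K n (S_tilde S \<zeta>)) (tderiv K m (tderiv K n (S \<zeta>)) t) t"
    by (subst has_tderiv_cong[OF t tderiv_S_tilde])
  then show ?thesis
    using tderiv_eq[OF t] tderiv_commute[OF smooth_S t] by metis
qed

text \<open>The value of \<open>D(z) S(\<zeta>)\<close>, the contribution of \<open>S\<^sub>0\<close> being summed in closed form.\<close>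

definition vertex_S :: "complex \<Rightarrow> complex \<Rightarrow> times \<Rightarrow> complex" where
  "vertex_S z \<zeta> t = vertex_op K z (S_tilde S \<zeta>) t - sato_log z \<zeta>"

lemma vertex_S_sums:
  assumes t: "t \<in> U" and z: "1 < norm z" "norm \<zeta> < norm z"
  shows "(\<lambda>n. vertex_coeff z n * tderiv K n (S \<zeta>) t) sums vertex_S z \<zeta> t"
proof -
  have "summable (\<lambda>n. vertex_coeff z n * tderiv K n (S_tilde S \<zeta>) t)"
    using vertex_termwise_S_tilde t z by (simp add: vertex_termwise_def vertex_summable_def)
  then have "(\<lambda>n. vertex_coeff z n * tderiv K n (S_tilde S \<zeta>) t) sums vertex_op K z (S_tilde S \<zeta>) t"
    unfolding vertex_op_def by (rule summable_sums)
  from sums_add[OF this sato_log_sums[OF z(2)]] show ?thesis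
    by (simp add: vertex_S_def tderiv_S_tilde[OF t] algebra_simps)
qed

lemma eventually_vertex_S_sums:
  assumes t: "t \<in> U"
  shows "\<forall>\<^sub>F z in at_infinity. (\<lambda>n. vertex_coeff z n * tderiv K n (S \<zeta>) t) sums vertex_S z \<zeta> t"
  using eventually_norm_gt[of 1] eventually_norm_gt[of "norm \<zeta>"]
  by eventually_elim (rule vertex_S_sums[OF t])

lemma vertex_S_tendsto_0:
  assumes t: "t \<in> U"
  shows "((\<lambda>z. vertex_S z \<zeta> t) \<longlongrightarrow> 0) at_infinity"
  by (rule tendsto_0_if_mult_ident_tendsto[OF vertex_series_leading_term[OF eventually_vertex_S_sums[OF t]]])

lemma eventually_norm_vertex_S_less_1:
  assumes t: "t \<in> U"
  shows "\<forall>\<^sub>F z in at_infinity. norm (vertex_S z \<zeta> t) < 1"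
  using tendstoD[OF vertex_S_tendsto_0[OF t], of 1] by simp

text \<open>The factor \<open>(z - \<zeta>) / (z + \<zeta>)\<close> of the hierarchy is
  \<open>exp (sato_log z \<zeta>)\<close>, which \<open>vertex_S\<close> absorbs.\<close>

lemma exp_vertex_S:
  assumes t: "t \<in> U" and z: "1 < norm z" "norm \<zeta> < norm z"
  shows "exp (- vertex_S z \<zeta> t) = (p_fun K S z t - p_fun K S \<zeta> t) / (p_fun K S z t + p_fun K S \<zeta> t)"
proof -
  have "(z - \<zeta>) / (z + \<zeta>) \<noteq> 0" "\<zeta> \<noteq> - z"
    using add_nonzero_if_norm_less[OF z(2)] z by auto
  then show ?thesis
    using hierarchy[OF t z(1)] exp_add[of "- vertex_op K z (S_tilde S \<zeta>) t" "sato_log z \<zeta>"]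
    by (simp add: vertex_S_def sato_log_def mult.commute)
qed

text \<open>Smallness keeps the imaginary part inside the strip where \<open>Ln\<close> inverts
  \<open>exp\<close>, which fixes the branch.\<close>

lemma sato_log_p_fun:
  assumes t: "t \<in> U" and z: "1 < norm z" "norm \<zeta> < norm z" and small: "norm (vertex_S z \<zeta> t) < 1"
  shows "sato_log (p_fun K S z t) (p_fun K S \<zeta> t) = - vertex_S z \<zeta> t"
proof -
  have "\<bar>Im (vertex_S z \<zeta> t)\<bar> < pi"
    using small abs_Im_le_cmod[of "vertex_S z \<zeta> t"] pi_gt3 by linarith
  then show ?thesis
    unfolding sato_log_def exp_vertex_S[OF t z, symmetric] by (intro Ln_exp) auto
qed

lemma has_tderiv_vertex_S:
  assumes t: "t \<in> U" and z: "1 < norm z"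
  shows "vertex_summable K z (p_fun K S \<zeta>) t"
    and "has_tderiv K 0 (vertex_S z \<zeta>) (vertex_op K z (p_fun K S \<zeta>) t) t"
proof -
  let ?f = "\<lambda>n. vertex_coeff z n * tderiv K 0 (tderiv K n (S_tilde S \<zeta>)) t"
  have f: "?f = (\<lambda>n. vertex_coeff z n * tderiv K n (p_fun K S \<zeta>) t)"
    by (simp add: p_fun_eq tderiv_tderiv_S_tilde[OF t])
  have *: "summable ?f" "has_tderiv K 0 (vertex_op K z (S_tilde S \<zeta>)) (suminf ?f) t"
    using vertex_termwise_S_tilde t z by (auto simp: vertex_termwise_def)
  show "vertex_summable K z (p_fun K S \<zeta>) t"
    using * by (simp add: vertex_summable_def f)
  show "has_tderiv K 0 (vertex_S z \<zeta>) (vertex_op K z (p_fun K S \<zeta>) t) t"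
    using *(2) unfolding f has_tderiv_def vertex_S_def vertex_op_def
    by (auto intro!: derivative_eq_intros)
qed

section \<open>Behaviour of \<open>p(z)\<close> at infinity\<close>

lemma p_fun_expansion:
  assumes t: "t \<in> U"
  shows "((\<lambda>z. z * (p_fun K S z t - z)) \<longlongrightarrow> tderiv K 0 (a 1) t) at_infinity"
proof -
  \<comment> \<open>The right side is \<open>p(z) - z\<close>, so its leading term is
    \<open>tderiv K 0 (a 1) t / z\<close>, that is \<open>- u / z\<close>.\<close>
  have "\<forall>\<^sub>F z in at_infinity. (\<lambda>i. tderiv K 0 (a (Suc i)) t * inverse z ^ Suc i) sums tderiv K 0 (S_tilde S z) t"
    using S t by (auto simp: dBKP_solution_def)
  then show ?thesis
    using tendsto_at_infinity_power_series[of "\<lambda>i. tderiv K 0 (a (Suc i)) t" "\<lambda>z. tderiv K 0 (S_tilde S z) t"]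
    by (simp add: tderiv_S_tilde[OF t] p_fun_eq)
qed

lemma p_fun_minus_tendsto_0:
  assumes t: "t \<in> U"
  shows "((\<lambda>z. p_fun K S z t - z) \<longlongrightarrow> 0) at_infinity"
  by (rule tendsto_0_if_mult_ident_tendsto[OF p_fun_expansion[OF t]])

lemma filterlim_p_fun:
  assumes t: "t \<in> U"
  shows "filterlim (\<lambda>z. p_fun K S z t) at_infinity at_infinity"
proof -
  have "filterlim (\<lambda>z. (p_fun K S z t - z) + z) at_infinity at_infinity"
    by (intro tendsto_add_filterlim_at_infinity[OF p_fun_minus_tendsto_0[OF t]] filterlim_ident)
  then show ?thesis by simp
qed

text \<open>Used to convert coefficients in powers of \<open>1/p\<close> into coefficients in powers
  of \<open>1/z\<close>.\<close>

lemma p_fun_ratio_tendsto_1: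
  assumes t: "t \<in> U"
  shows "((\<lambda>z. z / p_fun K S z t) \<longlongrightarrow> 1) at_infinity"
proof -
  have "((\<lambda>z. 1 - (p_fun K S z t - z) / p_fun K S z t) \<longlongrightarrow> 1 - 0) at_infinity"
    by (intro tendsto_intros tendsto_divide_0[OF p_fun_minus_tendsto_0[OF t] filterlim_p_fun[OF t]])
  moreover have "\<forall>\<^sub>F z in at_infinity. 1 - (p_fun K S z t - z) / p_fun K S z t = z / p_fun K S z t"
    using filterlim_p_fun[OF t, THEN filterlim_at_infinity_imp_eventually_ne, of 0]
    by eventually_elim (simp add: divide_simps)
  ultimately show ?thesis
    using Lim_transform_eventually by fastforce
qed

text \<open>Compare the coefficients of \<open>z\<^sup>-\<^sup>3\<close> in \<open>D(z) S(\<zeta>) = - ln ((p(z) - q) / (p(z) + q))\<close>.\<close>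

lemma tderiv_1_S:
  assumes t: "t \<in> U"
  shows "tderiv K 1 (S \<zeta>) t = p_fun K S \<zeta> t ^ 3 - 3 * tderiv K 0 (a 1) t * p_fun K S \<zeta> t"
proof -
  define q where "q = p_fun K S \<zeta> t"
  define P where "P z = p_fun K S z t" for z
  define L where "L z = vertex_S z \<zeta> t" for z
  define u where "u = - tderiv K 0 (a 1) t"
  have P: "filterlim P at_infinity at_infinity" unfolding P_def by (rule filterlim_p_fun[OF t])
  have ratio: "((\<lambda>z. z / P z) \<longlongrightarrow> 1) at_infinity" unfolding P_def by (rule p_fun_ratio_tendsto_1[OF t])
  have lim_S: "((\<lambda>z. z ^ 3 * (L z - 2 * q / z)) \<longlongrightarrow> 2 / 3 * tderiv K 1 (S \<zeta>) t) at_infinity"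
    using vertex_series_second_term[OF eventually_vertex_S_sums[OF t, of \<zeta>]]
    by (simp add: L_def q_def p_fun_eq)
  \<comment> \<open>The same coefficient is first read off in the variable \<open>P\<close>, then
    \<open>P = p(z)\<close> is substituted and rescaled by powers of \<open>z / P z\<close>.\<close>
  have "\<forall>\<^sub>F P in at_infinity. (\<lambda>n. vertex_coeff P n * q ^ (2 * n + 1)) sums (- sato_log P q)"
    using eventually_norm_gt[of "norm q"] by eventually_elim (rule sato_log_sums)
  from vertex_series_second_term[OF this]
  have "((\<lambda>P. P ^ 3 * (- sato_log P q - 2 * q / P)) \<longlongrightarrow> 2 / 3 * q ^ 3) at_infinity"
    by (simp add: power3_eq_cube)
  from filterlim_compose[OF this P]
  have "((\<lambda>z. P z ^ 3 * (- sato_log (P z) q - 2 * q / P z)) \<longlongrightarrow> 2 / 3 * q ^ 3) at_infinity" .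
  from tendsto_mult[OF tendsto_power[OF ratio, of 3] this]
  have lim_P: "((\<lambda>z. (z / P z) ^ 3 * (P z ^ 3 * (- sato_log (P z) q - 2 * q / P z))) \<longlongrightarrow> 2 / 3 * q ^ 3) at_infinity"
    by simp
  have "((\<lambda>z. z * (P z - z)) \<longlongrightarrow> - u) at_infinity"
    using p_fun_expansion[OF t] by (simp add: P_def u_def)
  \<comment> \<open>The function below equals \<open>z ^ 3 * (2 * q / P z - 2 * q / z)\<close>, the
    error of replacing \<open>1/P\<close> by \<open>1/z\<close> in the leading term. Its limit
    \<open>2 * q * u\<close> is the source of \<open>3 * u * q\<close>.\<close>
  from tendsto_mult[OF tendsto_mult[OF tendsto_const ratio] tendsto_minus[OF this]]
  have lim_diff: "((\<lambda>z. 2 * q * (z / P z) * - (z * (P z - z))) \<longlongrightarrow> 2 * q * 1 * (- (- u))) at_infinity" .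
  have L: "\<forall>\<^sub>F z in at_infinity. - sato_log (P z) q = L z"
    using eventually_norm_vertex_S_less_1[OF t, of \<zeta>] eventually_norm_gt[of 1] eventually_norm_gt[of "norm \<zeta>"]
    by eventually_elim (simp add: P_def q_def L_def sato_log_p_fun[OF t])
  have "\<forall>\<^sub>F z in at_infinity.
      (z / P z) ^ 3 * (P z ^ 3 * (- sato_log (P z) q - 2 * q / P z)) + 2 * q * (z / P z) * - (z * (P z - z)) =
      z ^ 3 * (L z - 2 * q / z)"
    using L eventually_not_equal_at_infinity[of 0] filterlim_at_infinity_imp_eventually_ne[OF P, of 0]
    by eventually_elim (simp add: field_simps power3_eq_cube)
  with tendsto_add[OF lim_P lim_diff]
  have "((\<lambda>z. z ^ 3 * (L z - 2 * q / z)) \<longlongrightarrow> 2 / 3 * q ^ 3 + 2 * q * 1 * (- (- u))) at_infinity"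
    by (rule Lim_transform_eventually)
  from tendsto_unique[OF trivial_limit_at_infinity lim_S this] have "2 / 3 * tderiv K 1 (S \<zeta>) t = 2 / 3 * q ^ 3 + 2 * q * u"
    by simp
  then have "2 / 3 * tderiv K 1 (S \<zeta>) t = 2 / 3 * (q ^ 3 + 3 * u * q)"
    by (simp add: algebra_simps)
  then have "tderiv K 1 (S \<zeta>) t = q ^ 3 + 3 * u * q"
    unfolding mult_cancel_left by simp
  then show ?thesis by (simp add: q_def u_def)
qed

end

subsection \<open>The symmetry constraint\<close>

locale dBKP_constrained = dBKP +
  fixes F :: "times \<Rightarrow> complex" and N :: nat and \<zeta> c :: "nat \<Rightarrow> complex"
  assumes F: "tau_function K U S F"
    and constraint: "\<And>t. t \<in> U \<Longrightarrow> tderiv K 0 F t = (\<Sum>i=1..N. c i * S (\<zeta> i) t)"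
begin

lemma eventually_norm_gt_points: "\<forall>\<^sub>F z in at_infinity. \<forall>i\<in>{1..N}. norm (\<zeta> i) < norm (z :: complex)"
  by (intro eventually_ball_finite ballI eventually_norm_gt) simp

text \<open>Differentiate \<open>S_tilde S z = - vertex_op K z F\<close> termwise in
  \<open>x\<close>, exchange derivatives of \<open>F\<close> and insert the constraint. Convergence
  of this combined series comes from \<open>F\<close>; splitting it over \<open>i\<close> is left to
  large \<open>z\<close>.\<close>

lemma p_fun_minus_sums:
  assumes t: "t \<in> U" and z: "1 < norm z"
  shows "(\<lambda>n. vertex_coeff z n * - (\<Sum>i=1..N. c i * tderiv K n (S (\<zeta> i)) t)) sums (p_fun K S z t - z)"
proof -
  have F': "smooth_in_times K U F" "vertex_termwise K U F"
    "\<And>t. t \<in> U \<Longrightarrow> S_tilde S z t = - vertex_op K z F t"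
    using F z by (auto simp: tau_function_def)
  have mixed: "tderiv K 0 (tderiv K n F) t = (\<Sum>i=1..N. c i * tderiv K n (S (\<zeta> i)) t)" for n
  proof -
    have "tderiv K 0 (tderiv K n F) t = tderiv K n (tderiv K 0 F) t"
      by (rule tderiv_commute[OF F'(1) t])
    also have "\<dots> = tderiv K n (\<lambda>t. \<Sum>i=1..N. c i * S (\<zeta> i) t) t"
      by (rule tderiv_cong[OF t constraint])
    also have "\<dots> = (\<Sum>i=1..N. c i * tderiv K n (S (\<zeta> i)) t)"
      using has_tderiv_S[OF t, of n] unfolding has_tderiv_def
      by (intro tderiv_eq[OF t]) (auto simp: has_tderiv_def intro!: DERIV_sum DERIV_cmult)
    finally show ?thesis .
  qed
  have "summable (\<lambda>n. vertex_coeff z n * tderiv K 0 (tderiv K n F) t)"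
    "has_tderiv K 0 (vertex_op K z F) (\<Sum>n. vertex_coeff z n * tderiv K 0 (tderiv K n F) t) t"
    using F'(2) t z by (auto simp: vertex_termwise_def)
  note * = this[unfolded mixed]
  have "has_tderiv K 0 (\<lambda>t. - vertex_op K z F t)
      (- (\<Sum>n. vertex_coeff z n * (\<Sum>i=1..N. c i * tderiv K n (S (\<zeta> i)) t))) t"
    using *(2) unfolding has_tderiv_def by (rule DERIV_minus)
  then have "has_tderiv K 0 (S_tilde S z)
      (- (\<Sum>n. vertex_coeff z n * (\<Sum>i=1..N. c i * tderiv K n (S (\<zeta> i)) t))) t"
    by (subst has_tderiv_cong[OF t F'(3)])
  from has_tderiv_unique[OF t has_tderiv_S_tilde[OF t] this]
  have "p_fun K S z t - z = - (\<Sum>n. vertex_coeff z n * (\<Sum>i=1..N. c i * tderiv K n (S (\<zeta> i)) t))"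
    by (simp add: p_fun_eq)
  then show ?thesis
    using sums_minus[OF summable_sums[OF *(1)]] by simp
qed

lemma p_fun_minus_eq:
  assumes t: "t \<in> U" and z: "1 < norm z" "\<And>i. i \<in> {1..N} \<Longrightarrow> norm (\<zeta> i) < norm z"
  shows "p_fun K S z t - z = - (\<Sum>i=1..N. c i * vertex_S z (\<zeta> i) t)"
proof -
  have "(\<lambda>n. - (\<Sum>i=1..N. c i * (vertex_coeff z n * tderiv K n (S (\<zeta> i)) t)))
      sums (- (\<Sum>i=1..N. c i * vertex_S z (\<zeta> i) t))"
    by (intro sums_minus sums_sum sums_mult vertex_S_sums[OF t] z)
  then show ?thesis
    using sums_unique2[OF p_fun_minus_sums[OF t z(1)]]
    by (simp add: sum_distrib_left mult.left_commute)
qed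

text \<open>Two expansions of \<open>p(z) - z\<close>, from \<open>S_tilde\<close> and from the
  constraint, have the same \<open>1/z\<close> coefficient.\<close>

lemma tderiv_0_a_1:
  assumes t: "t \<in> U"
  shows "tderiv K 0 (a 1) t = - 2 * (\<Sum>i=1..N. c i * p_fun K S (\<zeta> i) t)"
proof -
  have "\<forall>\<^sub>F z in at_infinity.
      (\<lambda>n. vertex_coeff z n * - (\<Sum>i=1..N. c i * tderiv K n (S (\<zeta> i)) t)) sums (p_fun K S z t - z)"
    using eventually_norm_gt[of 1] by eventually_elim (rule p_fun_minus_sums[OF t])
  from tendsto_unique[OF trivial_limit_at_infinity p_fun_expansion[OF t] vertex_series_leading_term[OF this]]
  show ?thesis by (simp add: p_fun_eq)
qed

text \<open>\<open>p\<close> is the \<open>x\<close>-derivative of \<open>S\<close>, so exchanging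
  derivatives makes this the \<open>x\<close>-derivative of \<open>tderiv_1_S\<close>; the 6 is
  \<open>- 3\<close> times the \<open>- 2\<close> of \<open>tderiv_0_a_1\<close>.\<close>

lemma tderiv_1_p_fun:
  assumes t: "t \<in> U"
  shows "tderiv K 1 (p_fun K S z) t = tderiv K 0 (\<lambda>t'. p_fun K S z t' ^ 3 +
           6 * p_fun K S z t' * (\<Sum>i=1..N. c i * p_fun K S (\<zeta> i) t')) t"
  unfolding p_fun_eq[of z] tderiv_commute[OF smooth_S t, of 1 0]
  by (rule tderiv_cong[OF t]) (simp only: tderiv_1_S tderiv_0_a_1 p_fun_eq, simp add: algebra_simps)

text \<open>The bounds are explicit at each \<open>t\<close> so that the relation can be used for
  one fixed \<open>z\<close> at all nearby times.\<close>

lemma sato_p_fun: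
  assumes t: "t \<in> U" and z: "1 < norm z" "\<And>i. i \<in> {1..N} \<Longrightarrow> norm (\<zeta> i) < norm z"
    and small: "\<And>i. i \<in> {1..N} \<Longrightarrow> norm (vertex_S z (\<zeta> i) t) < 1"
  shows "sato N c (\<lambda>i. p_fun K S (\<zeta> i) t) (p_fun K S z t) = z"
proof -
  have "(\<Sum>i=1..N. c i * sato_log (p_fun K S z t) (p_fun K S (\<zeta> i) t)) =
      - (\<Sum>i=1..N. c i * vertex_S z (\<zeta> i) t)"
    unfolding sum_negf[symmetric] by (intro sum.cong) (simp_all add: sato_log_p_fun[OF t z(1) z(2) small])
  then show ?thesis
    using p_fun_minus_eq[OF t z] by (simp add: sato_def diff_eq_eq)
qed

lemma eventually_vertex_S_small:
  assumes t: "t \<in> U"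
  shows "\<forall>\<^sub>F z in at_infinity. \<forall>i\<in>{1..N}. norm (vertex_S z (\<zeta> i) t) < 1"
  by (intro eventually_ball_finite ballI eventually_norm_vertex_S_less_1[OF t]) simp

lemma eventually_sato_p_fun:
  assumes t: "t \<in> U"
  shows "\<forall>\<^sub>F z in at_infinity.
           (\<forall>i\<in>{1..N}. norm (p_fun K S (\<zeta> i) t) < norm (p_fun K S z t)) \<and>
           z = sato N c (\<lambda>i. p_fun K S (\<zeta> i) t) (p_fun K S z t)"
proof -
  have "\<forall>\<^sub>F P in at_infinity. \<forall>i\<in>{1..N}. norm (p_fun K S (\<zeta> i) t) < norm (P :: complex)"
    by (intro eventually_ball_finite ballI eventually_norm_gt) simp
  from eventually_compose_filterlim[OF this filterlim_p_fun[OF t]]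
  show ?thesis
    using eventually_norm_gt[of 1] eventually_norm_gt_points eventually_vertex_S_small[OF t]
    by eventually_elim (auto intro!: sato_p_fun[OF t, symmetric])
qed

section \<open>The generating system\<close>

lemma generating_system:
  assumes t: "t \<in> U" and k: "k \<in> {1..N}"
  shows "\<forall>\<^sub>F z in at_infinity.
           (\<exists>!P. sato_branch N c (\<lambda>i. p_fun K S (\<zeta> i) t) z P) \<and>
           p_fun K S z t = sato_inv N c (\<lambda>i. p_fun K S (\<zeta> i) t) z \<and>
           vertex_summable K z (p_fun K S (\<zeta> k)) t \<and>
           has_tderiv K 0 (\<lambda>t'. sato_log (sato_inv N c (\<lambda>i. p_fun K S (\<zeta> i) t') z) (p_fun K S (\<zeta> k) t'))
             (- vertex_op K z (p_fun K S (\<zeta> k)) t) t"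
proof -
  \<comment> \<open>One bound for all \<open>k\<close>; the added 1 makes it strict, so it survives
    a small change of \<open>x\<close>.\<close>
  define M where "M = 1 + (\<Sum>i=1..N. norm (p_fun K S (\<zeta> i) t))"
  have M: "norm (p_fun K S (\<zeta> i) t) < M" if "i \<in> {1..N}" for i
    using member_le_sum[OF that, of "\<lambda>i. norm (p_fun K S (\<zeta> i) t)"] by (simp add: M_def)
  have "0 \<le> M" by (simp add: M_def sum_nonneg add_nonneg_nonneg)
  note unique = sato_branch_unique[OF this, of N c]
  have "\<forall>\<^sub>F z in at_infinity. norm (p_fun K S z t - z) < 1"
    using tendstoD[OF p_fun_minus_tendsto_0[OF t], of 1] by simp
  then show ?thesis
    using unique eventually_norm_gt[of 1] eventually_norm_gt_points eventually_vertex_S_small[OF t]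
  proof eventually_elim
    case (elim z)
    note z = elim(3) bspec[OF elim(4)]
    have inv: "sato_branch N c (\<lambda>i. p_fun K S (\<zeta> i) t') z (p_fun K S z t') \<and>
        sato_inv N c (\<lambda>i. p_fun K S (\<zeta> i) t') z = p_fun K S z t' \<and>
        (\<exists>!P. sato_branch N c (\<lambda>i. p_fun K S (\<zeta> i) t') z P)"
      if t': "t' \<in> U" "norm (p_fun K S z t' - z) < 1" "\<forall>i\<in>{1..N}. norm (vertex_S z (\<zeta> i) t') < 1"
        "\<forall>i\<in>{1..N}. norm (p_fun K S (\<zeta> i) t') < M" for t'
    proof -
      have branch: "sato_branch N c (\<lambda>i. p_fun K S (\<zeta> i) t') z (p_fun K S z t')"
        using sato_p_fun[OF t'(1) z] t' by (simp add: sato_branch_def)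
      moreover have "P = p_fun K S z t'" if "sato_branch N c (\<lambda>i. p_fun K S (\<zeta> i) t') z P" for P
        using elim(2) branch that t'(4) by (metis less_imp_le)
      ultimately show ?thesis
        unfolding sato_inv_def by (metis the_equality)
    qed
    \<comment> \<open>The bounds required by \<open>inv\<close> are strict and concern functions
      continuous in \<open>x\<close>, so they persist near \<open>t 0\<close> with \<open>z\<close>
      fixed. There the logarithm equals \<open>- vertex_S\<close>, whose \<open>x\<close>-derivative
      is known.\<close>
    have "\<forall>\<^sub>F s in at (t 0) within K. norm (p_fun K S z (t(0 := s)) - z) < 1"
      using order_tendstoD(2)[OF tendsto_norm[OF tendsto_diff[OF has_tderiv_tendsto[OF has_tderiv_p_fun[OF t]] tendsto_const]] elim(1)] .
    moreover have "\<forall>\<^sub>F s in at (t 0) within K. \<forall>i\<in>{1..N}. norm (vertex_S z (\<zeta> i) (t(0 := s))) < 1"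
      using elim(5) order_tendstoD(2)[OF tendsto_norm[OF has_tderiv_tendsto[OF has_tderiv_vertex_S(2)[OF t z(1)]]]]
      by (intro eventually_ball_finite) auto
    moreover have "\<forall>\<^sub>F s in at (t 0) within K. \<forall>i\<in>{1..N}. norm (p_fun K S (\<zeta> i) (t(0 := s))) < M"
      using M order_tendstoD(2)[OF tendsto_norm[OF has_tderiv_tendsto[OF has_tderiv_p_fun[OF t]]]]
      by (intro eventually_ball_finite) auto
    ultimately have "\<forall>\<^sub>F s in at (t 0) within K.
        - vertex_S z (\<zeta> k) (t(0 := s)) =
        sato_log (sato_inv N c (\<lambda>i. p_fun K S (\<zeta> i) (t(0 := s))) z) (p_fun K S (\<zeta> k) (t(0 := s)))"
      using eventually_line_mem[OF t, of 0]
      by eventually_elim (use inv sato_log_p_fun[OF _ z(1) z(2)[OF k]] k in simp)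
    moreover have "- vertex_S z (\<zeta> k) t =
        sato_log (sato_inv N c (\<lambda>i. p_fun K S (\<zeta> i) t) z) (p_fun K S (\<zeta> k) t)"
      using inv[OF t] elim M sato_log_p_fun[OF t z(1) z(2)[OF k]] k by simp
    ultimately have "has_tderiv K 0 (\<lambda>t'. - vertex_S z (\<zeta> k) t') d t \<longleftrightarrow> has_tderiv K 0
        (\<lambda>t'. sato_log (sato_inv N c (\<lambda>i. p_fun K S (\<zeta> i) t') z) (p_fun K S (\<zeta> k) t')) d t" for d
      by (intro has_tderiv_cong_eventually)
    moreover have "has_tderiv K 0 (\<lambda>t'. - vertex_S z (\<zeta> k) t') (- vertex_op K z (p_fun K S (\<zeta> k)) t) t"
      using has_tderiv_vertex_S(2)[OF t z(1)] unfolding has_tderiv_def by (rule DERIV_minus)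
    ultimately have "has_tderiv K 0
        (\<lambda>t'. sato_log (sato_inv N c (\<lambda>i. p_fun K S (\<zeta> i) t') z) (p_fun K S (\<zeta> k) t'))
        (- vertex_op K z (p_fun K S (\<zeta> k)) t) t"
      by simp
    then show ?case
      using inv[OF t] elim M has_tderiv_vertex_S(1)[OF t z(1)] by simp
  qed
qed

end

theorem mainTheorem8:
  fixes K :: "complex set" and U :: "times set"
    and S :: "complex \<Rightarrow> times \<Rightarrow> complex" and a :: "nat \<Rightarrow> times \<Rightarrow> complex"
    and F u :: "times \<Rightarrow> complex"
    and N :: nat and \<zeta> c :: "nat \<Rightarrow> complex"
    and p :: "complex \<Rightarrow> times \<Rightarrow> complex" and pk :: "nat \<Rightarrow> times \<Rightarrow> complex"
  assumes K: "K = \<real> \<or> K = UNIV"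
    and U: "time_domain K U"
    and S: "dBKP_solution K U S a"
    and F: "tau_function K U S F"
    and constraint: "\<And>t. t \<in> U \<Longrightarrow> tderiv K 0 F t = (\<Sum>i=1..N. c i * S (\<zeta> i) t)"
    and p: "p = p_fun K S"
    and pk: "pk = (\<lambda>k. p (\<zeta> k))"
    and u: "u = (\<lambda>t. - tderiv K 0 (a 1) t)"
  shows
    "(\<forall>t\<in>U.
        u t = 2 * (\<Sum>i=1..N. c i * pk i t) \<and>
        (\<forall>k\<in>{1..N}. tderiv K 1 (pk k) t =
           tderiv K 0 (\<lambda>t'. pk k t' ^ 3 + 6 * pk k t' * (\<Sum>i=1..N. c i * pk i t')) t)) \<and>
     (\<forall>t\<in>U.
        (\<forall>\<^sub>F z in at_infinity.
           (\<forall>i\<in>{1..N}. norm (pk i t) < norm (p z t)) \<and>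
           z = sato N c (\<lambda>i. pk i t) (p z t)) \<and>
        (\<forall>\<^sub>F P in at_infinity.
           (\<lambda>n. sato_coeff N c (\<lambda>i. pk i t) n * inverse P ^ (2 * n + 1))
             sums (sato N c (\<lambda>i. pk i t) P - P))) \<and>
     (\<forall>t\<in>U. \<forall>k\<in>{1..N}.
        \<forall>\<^sub>F z in at_infinity.
           (\<exists>!P. sato_branch N c (\<lambda>i. pk i t) z P) \<and>
           p z t = sato_inv N c (\<lambda>i. pk i t) z \<and>
           vertex_summable K z (pk k) t \<and>
           has_tderiv K 0 (\<lambda>t'. sato_log (sato_inv N c (\<lambda>i. pk i t') z) (pk k t'))
             (- vertex_op K z (pk k) t) t)"
proof -
  interpret dBKP_constrained K U S a F N \<zeta> c
    using K U S F constraint by unfold_locales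
  have u_eq: "- tderiv K 0 (a 1) t = 2 * (\<Sum>i=1..N. c i * p_fun K S (\<zeta> i) t)" if "t \<in> U" for t
    using tderiv_0_a_1[OF that] by simp
  show ?thesis
    unfolding u pk p
    by (intro conjI ballI)
       (assumption | rule u_eq tderiv_1_p_fun eventually_sato_p_fun sato_expansion generating_system)+
qed

end
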